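(* Consider the system, constraints, cost functions, sets and Algorithm 1 described in the context, and suppose that: (i) $(A,B)$ is stabilizable, and $K$ is such that $A_K=A+BK$ is Schur stable; (ii) $\mathcal Y\subseteq\mathbb R^p$ is compact, convex and $0\in\operatorname{int}\mathcal Y$; (iii) $\mathcal W\subseteq\mathbb R^o$ is compact, convex, $0\in\operatorname{int}\mathcal W$, and $w_t\in\mathcal W$ for all $t\in\mathbb N$; (iv) there are constants $l_L,\alpha_v,l_v>0$ such that for all $t\in\mathbb N$: $|L_t(u,x)-L_t(\tilde u,\tilde x)|\le l_L\|(u,x)-(\tilde u,\tilde x)\|$ for all $(u,x),(\tilde u,\tilde x)\in\mathcal Z:=\{(u,x)\in\mathbb R^m\times\mathbb R^n: C_ox+Du\in\mathcal Y\}$, and the steady-state cost $L_t^s(v):=L_t(v+KS_Kv,\,S_Kv)$ is $\alpha_v$-strongly convex with $l_v$-Lipschitz continuous gradient on $\mathcal S_v$; (v) the initial reference $r_0\in\overline{\mathcal S}_v$ satisfies $(r_0,x_0-S_Kr_0)\in\mathcal O_\infty^\lambda$. Then Algorithm 1 is recursively feasible. Moreover, along the closed loop resulting from Algorithm 1, the constraints $y_t\in\mathcal Y$ are satisfied for all $t\in\mathbb N$.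
   Context: Notation: $\mathbb N$ includes $0$; $\|\cdot\|$ is the Euclidean norm; $\mathcal S\oplus\mathcal T=\{s+t:s\in\mathcal S,t\in\mathcal T\}$; $\mathcal S\ominus\mathcal T=\{s: s+t\in\mathcal S\ \forall t\in\mathcal T\}$; $\Pi_{\mathcal S}(x)=\arg\min_{s\in\mathcal S}\|x-s\|^2$; $\rho(\cdot)$ is the spectral radius; Schur stable means $\rho<1$. System: $x_{t+1}=Ax_t+Bu_t+B_ww_t$, $x_t\in\mathbb R^n$, $u_t\in\mathbb R^m$, $w_t\in\mathbb R^o$, with given initial state $x_0$, constraint output $y_t=C_ox_t+Du_t+D_ww_t\in\mathbb R^p$, and constraints $y_t\in\mathcal Y$ for all $t\in\mathbb N$. The state $x_t$ is measured. Fix $K\in\mathbb R^{m\times n}$ with $A_K:=A+BK$ Schur stable, and put $u_t=v_t+Kx_t$ with virtual reference $v_t\in\mathbb R^m$. With $C:=C_o+DK$ this gives $x_{t+1}=A_Kx_t+Bv_t+B_ww_t$ and $y_t=Cx_t+Dv_t+D_ww_t$. Let $S_K:=(I_n-A_K)^{-1}B$ and $\mathcal S_v:=\{v\in\mathbb R^m:(CS_K+D)v\in\mathcal Y\ominus D_w\mathcal W\}$. Cost functions: $L_t:\mathbb R^m\times\mathbb R^n\to\mathbb R$, with arguments (input, state), are time-varying; at time $t$ only $L_0,\dots,L_{t-1}$ are known. Maximal output admissible set: fix $\lambda$ with $\rho(A_K)<\lambda<1$. $\mathcal O_\infty^\lambda$ is the set of all $(v,\epsilon)\in\mathbb R^m\times\mathbb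 R^n$ such that, with $\epsilon_0=\epsilon$ and $\epsilon_{t+1}=\frac1\lambda(A_K\epsilon_t+B_w\omega_t)$, one has $C\epsilon_t+(CS_K+D)v+D_w\omega_t\in\mathcal Y$ for all $t\in\mathbb N$ and all sequences $\omega_t\in\mathcal W$. Constraint tightening: $\mathcal P^\lambda\subseteq\mathbb R^n$ is a robust positively invariant set for $\epsilon_{t+1}=\frac1\lambda(A_K\epsilon_t+B_w\omega_t)$, $\omega_t\in\mathcal W$, i.e. $\frac1\lambda A_K\mathcal P^\lambda\oplus\frac1\lambda B_w\mathcal W\subseteq\mathcal P^\lambda$, containing the minimal such set: $\mathcal P^\lambda_\infty:=\bigoplus_{i=0}^\infty\left(\left(\frac1\lambda A_K\right)^i\frac1\lambda B_w\mathcal W\right)\subseteq\mathcal P^\lambda$. $\overline{\mathcal Y}$ is a convex, compact set with $0\in\overline{\mathcal Y}\subseteq\operatorname{int}\mathcal Y$. The tightened reference set is $\overline{\mathcal S}_v:=\{v\in\mathbb R^m:(CS_K+D)v\in\overline{\mathcal Y}\ominus D_w\mathcal W\ominus C\mathcal P^\lambda\}$. Algorithm 1 (robust OCO-RG scheme) with step size $\gamma\in(0,\frac{2}{\alpha_v+l_v}]$: at $t=0$ set $\alpha_0=1$, $v_0=r_0$, and apply $u_0=v_0+Kx_0$. At each $t\ge1$, given $x_t$: [S1] $r_t=\Pi_{\overline{\mathcal S}_v}\left(r_{t-1}-\gamma\nabla L^s_{t-1}(r_{t-1})\right)$; [S2] (reference governor problem) $\alpha_t$ is the maximal $\alpha\in[0,1]$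 such that $v:=v_{t-1}+\alpha(r_t-v_{t-1})$ satisfies $(v,x_t-S_Kv)\in\mathcal O_\infty^\lambda$, and $v_t=v_{t-1}+\alpha_t(r_t-v_{t-1})$; [S3] apply $u_t=v_t+Kx_t$. Recursive feasibility: Algorithm 1 is called recursively feasible if existence of a solution to the reference governor problem in [S2] at $t=0$ implies that there exists a feasible solution to it for all $t\in\mathbb N$. Since no optimization is performed at $t=0$, feasibility at $t=0$ means $(v_0,x_0-S_Kv_0)\in\mathcal O_\infty^\lambda$ with $v_0=r_0$. *)

theory Defs
  imports "HOL-Analysis.Analysis"
begin

text \<open>The supremum is over the complex eigenvalues of a real matrix; there are finitely many
  and at least one, so it is a maximum.\<close>

definition spectral_radius :: "real^'n^'n \<Rightarrow> real" where
  "spectral_radius M =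
     Sup {cmod c | c. \<exists>z :: complex^'n. z \<noteq> 0 \<and> (\<chi> i j. complex_of_real (M $ i $ j)) *v z = c *s z}"

definition schur_stable :: "real^'n^'n \<Rightarrow> bool" where
  "schur_stable M \<longleftrightarrow> spectral_radius M < 1"

definition stabilizable :: "real^'n^'n \<Rightarrow> real^'m^'n \<Rightarrow> bool" where
  "stabilizable A B \<longleftrightarrow> (\<exists>F. schur_stable (A + B ** F))"

text \<open>The Minkowski sum of two sets is \<open>+\<close> on sets from \<open>HOL-Library.Set_Algebras\<close>.\<close>

definition minkowski_diff :: "'a::plus set \<Rightarrow> 'a set \<Rightarrow> 'a set"  (infixl \<open>\<ominus>\<close> 65) where
  "S \<ominus> T = {s. \<forall>t\<in>T. s + t \<in> S}"

definition minkowski_series :: "(nat \<Rightarrow> 'a::real_normed_vector set) \<Rightarrow> 'a set" where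
  "minkowski_series S = {s. \<exists>f. (\<forall>i. f i \<in> S i) \<and> f sums s}"

definition strongly_convex_on :: "real \<Rightarrow> 'a::real_normed_vector set \<Rightarrow> ('a \<Rightarrow> real) \<Rightarrow> bool" where
  "strongly_convex_on \<alpha> S f \<longleftrightarrow> convex S \<and>
     (\<forall>x\<in>S. \<forall>y\<in>S. \<forall>\<theta>\<in>{0..1}.
        f ((1 - \<theta>) *\<^sub>R x + \<theta> *\<^sub>R y)
          \<le> (1 - \<theta>) * f x + \<theta> * f y - \<alpha> / 2 * \<theta> * (1 - \<theta>) * (norm (x - y))\<^sup>2)"

definition gradient :: "('a::real_inner \<Rightarrow> real) \<Rightarrow> 'a \<Rightarrow> 'a" where
  "gradient f x = (THE g. GDERIV f x :> g)"

definition steady_state_map :: "real^'n^'n \<Rightarrow> real^'m^'n \<Rightarrow> real^'m^'n" where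
  "steady_state_map A\<^sub>K B = matrix_inv (mat 1 - A\<^sub>K) ** B"

primrec error_traj ::
  "real \<Rightarrow> real^'n^'n \<Rightarrow> real^'o^'n \<Rightarrow> (nat \<Rightarrow> real^'o) \<Rightarrow> real^'n \<Rightarrow> nat \<Rightarrow> real^'n" where
  "error_traj l A\<^sub>K B\<^sub>w \<omega> \<epsilon> 0 = \<epsilon>"
| "error_traj l A\<^sub>K B\<^sub>w \<omega> \<epsilon> (Suc t) = (1 / l) *\<^sub>R (A\<^sub>K *v error_traj l A\<^sub>K B\<^sub>w \<omega> \<epsilon> t + B\<^sub>w *v \<omega> t)"

text \<open>Maximal output admissible set; \<open>G\<close> is the steady-state gain from reference to output.\<close>

definition moas ::
  "real \<Rightarrow> real^'n^'n \<Rightarrow> real^'o^'n \<Rightarrow> real^'n^'p \<Rightarrow> real^'m^'p \<Rightarrow> real^'o^'p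
     \<Rightarrow> (real^'o) set \<Rightarrow> (real^'p) set \<Rightarrow> ((real^'m) \<times> (real^'n)) set" where
  "moas l A\<^sub>K B\<^sub>w C G D\<^sub>w W Y =
     {(v, \<epsilon>). \<forall>\<omega>. (\<forall>t. \<omega> t \<in> W) \<longrightarrow>
        (\<forall>t. C *v error_traj l A\<^sub>K B\<^sub>w \<omega> \<epsilon> t + G *v v + D\<^sub>w *v \<omega> t \<in> Y)}"

text \<open>Minimal robust positively invariant set of the \<open>1/l\<close>-scaled error dynamics, with matrix
  powers written as iterated application.\<close>

definition min_rpi :: "real \<Rightarrow> real^'n^'n \<Rightarrow> real^'o^'n \<Rightarrow> (real^'o) set \<Rightarrow> (real^'n) set" where
  "min_rpi l A\<^sub>K B\<^sub>w W =
     minkowski_series (\<lambda>i. ((*v) ((1 / l) *\<^sub>R A\<^sub>K) ^^ i) ` (*v) ((1 / l) *\<^sub>R B\<^sub>w) ` W)"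

definition robust_pos_invariant ::
  "real \<Rightarrow> real^'n^'n \<Rightarrow> real^'o^'n \<Rightarrow> (real^'o) set \<Rightarrow> (real^'n) set \<Rightarrow> bool" where
  "robust_pos_invariant l A\<^sub>K B\<^sub>w W P \<longleftrightarrow>
     (*v) ((1 / l) *\<^sub>R A\<^sub>K) ` P + (*v) ((1 / l) *\<^sub>R B\<^sub>w) ` W \<subseteq> P"

text \<open>The reference governor problem with admissible set \<open>O\<^sub>a\<close>, measured state \<open>x\<close>, previous
  virtual reference \<open>v\<close> and desired reference \<open>r\<close>.\<close>

definition rg_feasible ::
  "((real^'m) \<times> (real^'n)) set \<Rightarrow> real^'m^'n \<Rightarrow> real^'n \<Rightarrow> real^'m \<Rightarrow> real^'m \<Rightarrow> real \<Rightarrow> bool" where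
  "rg_feasible O\<^sub>a S\<^sub>K x v r a \<longleftrightarrow>
     a \<in> {0..1} \<and> (let v' = v + a *\<^sub>R (r - v) in (v', x - S\<^sub>K *v v') \<in> O\<^sub>a)"

definition rg_solution ::
  "((real^'m) \<times> (real^'n)) set \<Rightarrow> real^'m^'n \<Rightarrow> real^'n \<Rightarrow> real^'m \<Rightarrow> real^'m \<Rightarrow> real \<Rightarrow> bool" where
  "rg_solution O\<^sub>a S\<^sub>K x v r a \<longleftrightarrow>
     rg_feasible O\<^sub>a S\<^sub>K x v r a \<and> (\<forall>b. rg_feasible O\<^sub>a S\<^sub>K x v r b \<longrightarrow> b \<le> a)"

text \<open>The closed loop is a total recursion: \<open>GREATEST\<close> is unspecified when the reference governor
  problem has no solution, so this predicate does not presuppose feasibility at any time.\<close>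

definition oco_rg_closed_loop ::
  "real^'n^'n \<Rightarrow> real^'m^'n \<Rightarrow> real^'o^'n \<Rightarrow> real^'n^'m \<Rightarrow> real^'m^'n
     \<Rightarrow> ((real^'m) \<times> (real^'n)) set \<Rightarrow> (real^'m) set \<Rightarrow> (nat \<Rightarrow> real^'m \<Rightarrow> real) \<Rightarrow> real
     \<Rightarrow> real^'n \<Rightarrow> real^'m \<Rightarrow> (nat \<Rightarrow> real^'o)
     \<Rightarrow> (nat \<Rightarrow> real^'n) \<Rightarrow> (nat \<Rightarrow> real^'m) \<Rightarrow> (nat \<Rightarrow> real^'m) \<Rightarrow> (nat \<Rightarrow> real^'m) \<Rightarrow> (nat \<Rightarrow> real)
     \<Rightarrow> bool" where
  "oco_rg_closed_loop A B B\<^sub>w K S\<^sub>K O\<^sub>a S\<^sub>r Ls \<gamma> x\<^sub>0 r\<^sub>0 w x u v r \<alpha> \<longleftrightarrow>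
     x 0 = x\<^sub>0 \<and> r 0 = r\<^sub>0 \<and> \<alpha> 0 = 1 \<and> v 0 = r\<^sub>0 \<and>
     (\<forall>t. u t = v t + K *v x t) \<and>
     (\<forall>t. x (Suc t) = A *v x t + B *v u t + B\<^sub>w *v w t) \<and>
     (\<forall>t. r (Suc t) = closest_point S\<^sub>r (r t - \<gamma> *\<^sub>R gradient (Ls t) (r t))) \<and>
     (\<forall>t. \<alpha> (Suc t) = (GREATEST a. rg_feasible O\<^sub>a S\<^sub>K (x (Suc t)) (v t) (r (Suc t)) a)) \<and>
     (\<forall>t. v (Suc t) = v t + \<alpha> (Suc t) *\<^sub>R (r (Suc t) - v t))"

text \<open>No optimization takes place at time 0, so feasibility there means admissibility of the
  initial pair.\<close>

fun rg_solvable_at ::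
  "((real^'m) \<times> (real^'n)) set \<Rightarrow> real^'m^'n \<Rightarrow> (nat \<Rightarrow> real^'n) \<Rightarrow> (nat \<Rightarrow> real^'m) \<Rightarrow> (nat \<Rightarrow> real^'m)
     \<Rightarrow> nat \<Rightarrow> bool" where
  "rg_solvable_at O\<^sub>a S\<^sub>K x v r 0 \<longleftrightarrow> (v 0, x 0 - S\<^sub>K *v v 0) \<in> O\<^sub>a"
| "rg_solvable_at O\<^sub>a S\<^sub>K x v r (Suc t) \<longleftrightarrow>
     (\<exists>a. rg_solution O\<^sub>a S\<^sub>K (x (Suc t)) (v t) (r (Suc t)) a)"

definition recursively_feasible ::
  "((real^'m) \<times> (real^'n)) set \<Rightarrow> real^'m^'n \<Rightarrow> (nat \<Rightarrow> real^'n) \<Rightarrow> (nat \<Rightarrow> real^'m) \<Rightarrow> (nat \<Rightarrow> real^'m)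
     \<Rightarrow> bool" where
  "recursively_feasible O\<^sub>a S\<^sub>K x v r \<longleftrightarrow>
     (rg_solvable_at O\<^sub>a S\<^sub>K x v r 0 \<longrightarrow> (\<forall>t. rg_solvable_at O\<^sub>a S\<^sub>K x v r t))"

end

theory Submission
  imports Defs "HOL-Computational_Algebra.Fundamental_Theorem_Algebra"
begin

text \<open>Because the error recursion is scaled by \<open>1/\<lambda>\<close>, one step of the true error dynamics maps an
  admissible pair \<open>(v, \<epsilon>)\<close> to a pair \<open>(v, \<epsilon>')\<close> such that \<open>(v, \<epsilon>'/\<lambda>)\<close> is admissible. The tightened
  references are exactly made so that \<open>(v, 0)\<close> is admissible as well: error trajectories from \<open>0\<close>
  stay in \<open>P\<close>. By convexity \<open>(v, \<epsilon>')\<close> is admissible, so \<open>\<alpha> = 0\<close> is feasible at the next step, and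
  a maximal \<open>\<alpha>\<close> exists because the admissible set is closed. The spectral radius enters through the
  invertibility of \<open>I - A\<^sub>K\<close> and through \<open>\<lambda> > \<rho>(A\<^sub>K) \<ge> 0\<close>, which requires an eigenvalue to exist.\<close>

section \<open>Eigenvalues and the spectral radius\<close>

text \<open>This is p(M) z, evaluated by Horner's rule directly on vectors, so that no matrix powers
  are formed.\<close>

definition poly_act :: "'a::field^'n^'n \<Rightarrow> 'a poly \<Rightarrow> 'a^'n \<Rightarrow> 'a^'n" where
  "poly_act M p z = fold_coeffs (\<lambda>a y. a *s z + M *v y) p 0"

lemma poly_act_0 [simp]: "poly_act M 0 z = 0"
  by (simp add: poly_act_def)

lemma poly_act_pCons [simp]: "poly_act M (pCons a p) z = a *s z + M *v poly_act M p z"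
  by (cases "p = 0 \<and> a = 0") (auto simp: poly_act_def fold_coeffs_pCons_not_0_0_eq)

lemma poly_act_add: "poly_act M (p + q) z = poly_act M p z + poly_act M q z"
  by (induction p q rule: poly_induct2)
    (simp_all add: vector_sadd_rdistrib matrix_vector_right_distrib)

lemma poly_act_smult: "poly_act M (smult c p) z = c *s poly_act M p z"
  by (induction p) (simp_all add: vector_ssub_ldistrib vector_add_ldistrib vector_smult_assoc
      vector_scalar_commute)

lemma poly_act_sum: "poly_act M (\<Sum>i\<in>I. f i) z = (\<Sum>i\<in>I. poly_act M (f i) z)"
  by (induction I rule: infinite_finite_induct) (simp_all add: poly_act_add)

lemma poly_act_diff: "poly_act M (p - q) z = poly_act M p z - poly_act M q z"
  using poly_act_add[of M p "smult (-1) q" z] poly_act_smult[of M "-1" q z]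
  by (simp add: vec_eq_iff)

lemma poly_act_monom: "poly_act M (monom c i) z = c *s (((*v) M ^^ i) z)"
  by (induction i) (simp_all add: monom_0 monom_Suc vector_scalar_commute)

lemma poly_act_matrix: "poly_act M p (M *v z) = M *v poly_act M p z"
  by (induction p) (simp_all add: matrix_vector_right_distrib vector_scalar_commute)

text \<open>Polynomials in M commute, so a factor M - c I split off from p(M) can be moved onto the
  vector.\<close>

lemma poly_act_linear_factor:
  "poly_act M ([:- c, 1:] * q) z = poly_act M q (M *v z - c *s z)"
proof -
  have "poly_act M q (M *v z - c *s z) = poly_act M q (M *v z) - c *s poly_act M q z"
  proof (induction q)
    case (pCons a q)
    show ?case
      unfolding poly_act_pCons pCons.IH matrix_vector_mult_diff_distrib vector_scalar_commute
      by (simp add: vec_eq_iff algebra_simps)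
  qed simp
  then show ?thesis
    by (simp add: poly_act_diff poly_act_smult poly_act_matrix)
qed

text \<open>Split off a root c of p. Either z is an eigenvector for c, or M z - c z is a nonzero
  vector annihilated by a polynomial of smaller degree; hence the induction on the degree with z
  arbitrary.\<close>

lemma eigenvector_if_poly_act_0:
  fixes M :: "complex^'n^'n"
  assumes "p \<noteq> 0" "z \<noteq> 0" "poly_act M p z = 0"
  shows "\<exists>c y. y \<noteq> 0 \<and> M *v y = c *s y"
  using assms
proof (induction "degree p" arbitrary: p z)
  case 0
  \<comment> \<open>A nonzero constant polynomial only scales z, so it cannot annihilate z.\<close>
  then obtain a where "p = [:a:]"
    by (metis degree_eq_zeroE)
  with 0 show ?case
    by simp
next
  case (Suc n)
  then have "\<not> constant (poly p)"
    by (simp add: constant_degree)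
  then obtain c where "poly p c = 0"
    using fundamental_theorem_of_algebra by blast
  then obtain q where q: "p = [:- c, 1:] * q"
    by (metis poly_eq_0_iff_dvd dvdE)
  show ?case
  proof (cases "M *v z = c *s z")
    case True
    then show ?thesis
      using Suc.prems by blast
  next
    case False
    have "q \<noteq> 0"
      using Suc.prems q by auto
    moreover have "degree p = degree [:- c, 1:] + degree q"
      unfolding q using \<open>q \<noteq> 0\<close> by (intro degree_mult_eq) auto
    then have "n = degree q"
      using Suc.hyps(2) by simp
    moreover have "poly_act M q (M *v z - c *s z) = 0"
      using Suc.prems(3) unfolding q poly_act_linear_factor .
    ultimately show ?thesis
      using Suc.hyps(1)[of q "M *v z - c *s z"] False by simp
  qed
qed

text \<open>The Krylov vectors z, M z, M^2 z, ... are eventually dependent, and the coefficients of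
  a linear relation are those of an annihilating polynomial.\<close>

lemma ex_poly_act_0:
  fixes M :: "complex^'n^'n"
  shows "\<exists>p. p \<noteq> 0 \<and> poly_act M p z = 0"
proof -
  define f where "f i = ((*v) M ^^ i) z" for i
  \<comment> \<open>This is the real dimension. Real coefficients suffice, since any nonzero
    polynomial will do.\<close>
  let ?N = "DIM(complex^'n)"
  show ?thesis
  proof (cases "inj_on f {..?N}")
    \<comment> \<open>Coinciding iterates would spoil the count of vectors below, but they give the
      polynomial X^i - X^j at once.\<close>
    case False
    then obtain i j where ij: "i \<noteq> j" "f i = f j"
      by (auto simp: inj_on_def)
    then have "monom 1 i - monom 1 j \<noteq> (0 :: complex poly)"
      by (simp add: monom_eq_iff')
    moreover have "poly_act M (monom 1 i - monom 1 j) z = 0"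
      using ij by (simp add: poly_act_diff poly_act_monom f_def)
    ultimately show ?thesis
      by blast
  next
    case True
    then have "dependent (f ` {..?N})"
      by (intro dependent_biggerset) (simp add: card_image)
    then obtain g where g: "(\<Sum>y\<in>f ` {..?N}. g y *\<^sub>R y) = 0" "\<exists>y\<in>f ` {..?N}. g y \<noteq> 0"
      by (auto simp: dependent_finite)
    then obtain k where k: "k \<le> ?N" "g (f k) \<noteq> 0"
      by auto
    let ?p = "\<Sum>i\<le>?N. monom (complex_of_real (g (f i))) i"
    have "coeff ?p k = complex_of_real (g (f k))"
      using k(1) by (simp add: coeff_sum)
    then have "?p \<noteq> 0"
      using k(2) by (metis coeff_0 of_real_eq_0_iff)
    moreover have "poly_act M ?p z = 0"
    proof -
      have "poly_act M ?p z = (\<Sum>i\<le>?N. g (f i) *\<^sub>R f i)"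
        by (simp add: poly_act_sum poly_act_monom f_def vec_eq_iff scaleR_conv_of_real[where 'a=complex])
      then show ?thesis
        using g(1) True by (simp add: sum.reindex)
    qed
    ultimately show ?thesis
      by blast
  qed
qed

lemma ex_eigenvector:
  fixes M :: "complex^'n^'n"
  shows "\<exists>c y. y \<noteq> 0 \<and> M *v y = c *s y"
proof -
  have "axis undefined 1 \<noteq> (0 :: complex^'n)"
    by (simp add: axis_eq_0_iff)
  then show ?thesis
    using ex_poly_act_0 eigenvector_if_poly_act_0 by blast
qed

text \<open>As in Gershgorin's theorem, compare both sides of the eigenvector equation in the row
  where z has its largest entry. The crude bound serves to make the set of eigenvalue moduli bounded
  above.\<close>

lemma cmod_eigenvalue_le:
  fixes M :: "complex^'n^'n"
  assumes "z \<noteq> 0" "M *v z = c *s z"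
  shows "cmod c \<le> (\<Sum>i\<in>UNIV. \<Sum>j\<in>UNIV. cmod (M $ i $ j))"
proof -
  obtain k where k: "\<And>i. cmod (z $ i) \<le> cmod (z $ k)"
  proof -
    have "Max (range (\<lambda>i. cmod (z $ i))) \<in> range (\<lambda>i. cmod (z $ i))"
      by (intro Max_in) auto
    then obtain k where "Max (range (\<lambda>i. cmod (z $ i))) = cmod (z $ k)"
      by blast
    then have "cmod (z $ i) \<le> cmod (z $ k)" for i
      by (metis Max_ge finite finite_imageI rangeI)
    then show ?thesis
      by (rule that)
  qed
  have pos: "cmod (z $ k) > 0"
  proof (rule ccontr)
    assume "\<not> ?thesis"
    then have "z $ i = 0" for i
      using k[of i] by simp
    with assms(1) show False
      by (simp add: vec_eq_iff)
  qed
  have "cmod c * cmod (z $ k) = cmod (\<Sum>j\<in>UNIV. M $ k $ j * z $ j)"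
    using arg_cong[OF assms(2), of "\<lambda>y. cmod (y $ k)"]
    by (simp add: matrix_vector_mult_def norm_mult)
  also have "\<dots> \<le> (\<Sum>j\<in>UNIV. cmod (M $ k $ j) * cmod (z $ k))"
    by (rule order_trans[OF norm_sum]) (auto simp: norm_mult intro!: sum_mono mult_left_mono k)
  also have "\<dots> = (\<Sum>j\<in>UNIV. cmod (M $ k $ j)) * cmod (z $ k)"
    by (simp add: sum_distrib_right)
  finally have "cmod c \<le> (\<Sum>j\<in>UNIV. cmod (M $ k $ j))"
    using pos by simp
  also have "\<dots> \<le> (\<Sum>i\<in>UNIV. \<Sum>j\<in>UNIV. cmod (M $ i $ j))"
    by (rule member_le_sum[of k UNIV "\<lambda>i. \<Sum>j\<in>UNIV. cmod (M $ i $ j)"]) (auto intro!: sum_nonneg)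
  finally show ?thesis .
qed

lemma cmod_eigenvalue_le_spectral_radius:
  fixes M :: "real^'n^'n"
  assumes "z \<noteq> 0" "(\<chi> i j. complex_of_real (M $ i $ j)) *v z = c *s z"
  shows "cmod c \<le> spectral_radius M"
  unfolding spectral_radius_def
proof (rule cSup_upper)
  show "bdd_above {cmod c |c. \<exists>z :: complex^'n. z \<noteq> 0 \<and>
      (\<chi> i j. complex_of_real (M $ i $ j)) *v z = c *s z}"
    by (rule bdd_aboveI) (auto dest: cmod_eigenvalue_le)
qed (use assms in blast)

text \<open>The supremum of an empty set would say nothing, so an eigenvalue has to be exhibited
  first.\<close>

lemma spectral_radius_nonneg: "0 \<le> spectral_radius M"
proof -
  obtain c z where "z \<noteq> 0" "(\<chi> i j. complex_of_real (M $ i $ j)) *v z = c *s z"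
    using ex_eigenvector by blast
  then have "cmod c \<le> spectral_radius M"
    by (rule cmod_eigenvalue_le_spectral_radius)
  then show ?thesis
    by (rule order_trans[OF norm_ge_zero])
qed

text \<open>A nonzero kernel vector of I - M would be an eigenvector of M for the eigenvalue 1,
  forcing the spectral radius to be at least 1.\<close>

lemma invertible_one_minus_schur_stable:
  fixes M :: "real^'n^'n"
  assumes "schur_stable M"
  shows "invertible (mat 1 - M)"
proof -
  have "z = 0" if "(mat 1 - M) *v z = 0" for z
  proof (rule ccontr)
    assume "z \<noteq> 0"
    have Mz: "M *v z = z"
      using that by (simp add: matrix_vector_mult_diff_rdistrib)
    \<comment> \<open>The spectral radius is defined by complex eigenvectors, so the real vector is
      complexified.\<close>
    let ?z = "(\<chi> i. complex_of_real (z $ i)) :: complex^'n"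
    have "(\<chi> i j. complex_of_real (M $ i $ j)) *v ?z = (\<chi> i. complex_of_real ((M *v z) $ i))"
      by (simp add: matrix_vector_mult_def)
    then have "(\<chi> i j. complex_of_real (M $ i $ j)) *v ?z = 1 *s ?z"
      using Mz by simp
    moreover have "?z \<noteq> 0"
      using \<open>z \<noteq> 0\<close> by (simp add: vec_eq_iff)
    ultimately have "cmod 1 \<le> spectral_radius M"
      by (rule cmod_eigenvalue_le_spectral_radius[rotated])
    with assms show False
      by (simp add: schur_stable_def)
  qed
  then show ?thesis
    by (simp add: invertible_left_inverse matrix_left_invertible_ker)
qed

lemma matrix_inv_right:
  assumes "invertible M"
  shows "M ** matrix_inv M = mat 1"
  using assms unfolding invertible_def matrix_inv_def by (rule someI2_ex) simp

text \<open>\<open>steady_state_map M B *v z\<close> is the equilibrium of the undisturbed loop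
  under the constant reference z; the identity rearranges (I - M) S = B.\<close>

lemma steady_state_map_fixpoint:
  fixes B :: "real^'m^'n"
  assumes "schur_stable M"
  shows "M *v (steady_state_map M B *v z) + B *v z = steady_state_map M B *v z"
proof -
  have "(mat 1 - M) ** steady_state_map M B = B"
    unfolding steady_state_map_def matrix_mul_assoc
    by (simp add: matrix_inv_right invertible_one_minus_schur_stable assms)
  then have "(mat 1 - M) *v (steady_state_map M B *v z) = B *v z"
    by (simp add: matrix_vector_mul_assoc)
  then show ?thesis
    by (simp add: matrix_vector_mult_diff_rdistrib algebra_simps)
qed

section \<open>The maximal output admissible set\<close>

text \<open>By time invariance, the first step can be peeled off instead of the last one.\<close>

lemma error_traj_Suc_shift:
  "error_traj l M B \<omega> \<epsilon> (Suc t)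
    = error_traj l M B (\<lambda>i. \<omega> (Suc i)) ((1 / l) *\<^sub>R (M *v \<epsilon> + B *v \<omega> 0)) t"
  by (induction t) simp_all

text \<open>For a fixed disturbance the trajectory is affine in its initial value, and s \<epsilon>
  is the combination s \<epsilon> + (1 - s) 0.\<close>

lemma error_traj_scaleR:
  "error_traj l M B \<omega> (s *\<^sub>R \<epsilon>) t
    = s *\<^sub>R error_traj l M B \<omega> \<epsilon> t + (1 - s) *\<^sub>R error_traj l M B \<omega> 0 t"
proof (induction t)
  case (Suc t)
  show ?case
    unfolding error_traj.simps Suc by (simp add: algebra_simps diff_divide_distrib)
qed simp

lemma continuous_on_matrix_vector_mult:
  fixes M :: "real^'n^'m"
  assumes "continuous_on S f"
  shows "continuous_on S (\<lambda>x. M *v f x)"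
  using continuous_on_compose2[OF matrix_vector_mult_linear_continuous_on[of UNIV M] assms] by simp

lemma continuous_on_error_traj:
  assumes "continuous_on S f"
  shows "continuous_on S (\<lambda>x. error_traj l M B \<omega> (f x) t)"
proof (induction t)
  case (Suc t)
  then show ?case
    unfolding error_traj.simps
    by (intro continuous_on_scaleR continuous_on_add continuous_on_const
        continuous_on_matrix_vector_mult)
qed (simp add: assms)

text \<open>This is the condition at time 0 for the constant disturbance sequence.\<close>

lemma moas_output:
  assumes "(v, \<epsilon>) \<in> moas l M B C G D W Y" "\<omega> \<in> W"
  shows "C *v \<epsilon> + G *v v + D *v \<omega> \<in> Y"
proof -
  have "\<forall>t. C *v error_traj l M B (\<lambda>_. \<omega>) \<epsilon> t + G *v v + D *v \<omega> \<in> Y"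
    using assms unfolding moas_def by fast
  then show ?thesis
    by (metis error_traj.simps(1))
qed

lemma moas_step:
  assumes "(v, \<epsilon>) \<in> moas l M B C G D W Y" "\<omega> \<in> W"
  shows "(v, (1 / l) *\<^sub>R (M *v \<epsilon> + B *v \<omega>)) \<in> moas l M B C G D W Y"
  unfolding moas_def
proof (clarify)
  fix \<eta> :: "nat \<Rightarrow> _" and t assume \<eta>: "\<forall>t. \<eta> t \<in> W"
  \<comment> \<open>Prepending \<omega> to \<eta> turns time t after the step into time t + 1 from
    the original error.\<close>
  define \<zeta> where "\<zeta> i = (case i of 0 \<Rightarrow> \<omega> | Suc j \<Rightarrow> \<eta> j)" for i
  have "\<forall>t. \<zeta> t \<in> W"
    using \<eta> assms(2) by (auto simp: \<zeta>_def split: nat.split)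
  with assms(1) have "C *v error_traj l M B \<zeta> \<epsilon> (Suc t) + G *v v + D *v \<zeta> (Suc t) \<in> Y"
    unfolding moas_def by blast
  then show "C *v error_traj l M B \<eta> ((1 / l) *\<^sub>R (M *v \<epsilon> + B *v \<omega>)) t + G *v v + D *v \<eta> t \<in> Y"
    unfolding error_traj_Suc_shift by (simp add: \<zeta>_def)
qed

lemma moas_scaleR:
  assumes "convex Y" "(v, \<epsilon>) \<in> moas l M B C G D W Y" "(v, 0) \<in> moas l M B C G D W Y"
    and "0 \<le> s" "s \<le> 1"
  shows "(v, s *\<^sub>R \<epsilon>) \<in> moas l M B C G D W Y"
  unfolding moas_def
proof (clarify)
  fix \<omega> :: "nat \<Rightarrow> _" and t assume \<omega>: "\<forall>t. \<omega> t \<in> W"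
  let ?a = "C *v error_traj l M B \<omega> \<epsilon> t + G *v v + D *v \<omega> t"
  let ?b = "C *v error_traj l M B \<omega> 0 t + G *v v + D *v \<omega> t"
  have "?a \<in> Y" "?b \<in> Y"
    using assms(2,3) \<omega> unfolding moas_def by blast+
  then have "s *\<^sub>R ?a + (1 - s) *\<^sub>R ?b \<in> Y"
    using assms(1,4,5) by (simp add: convexD)
  also have "s *\<^sub>R ?a + (1 - s) *\<^sub>R ?b
      = C *v error_traj l M B \<omega> (s *\<^sub>R \<epsilon>) t + G *v v + D *v \<omega> t"
    by (simp add: error_traj_scaleR[of _ _ _ _ s] matrix_vector_right_distrib
        matrix_vector_mult_scaleR algebra_simps)
  finally show "C *v error_traj l M B \<omega> (s *\<^sub>R \<epsilon>) t + G *v v + D *v \<omega> t \<in> Y" .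
qed

text \<open>For each fixed disturbance sequence and time, the output is continuous in the pair, so
  the set is an intersection of closed preimages.\<close>

lemma closed_moas:
  assumes "closed Y"
  shows "closed (moas l M B C G D W Y)"
proof -
  have eq: "moas l M B C G D W Y = (\<Inter>\<omega>\<in>{\<omega>. \<forall>t. \<omega> t \<in> W}. \<Inter>t.
      (\<lambda>z. C *v error_traj l M B \<omega> (snd z) t + G *v fst z + D *v \<omega> t) -` Y)"
    by (auto simp: moas_def)
  show ?thesis
    unfolding eq
    by (intro closed_INT ballI closed_vimage assms continuous_on_add continuous_on_const
        continuous_on_matrix_vector_mult continuous_on_error_traj continuous_on_fst
        continuous_on_snd continuous_on_id)
qed

lemma error_traj_0_in_rpi:
  assumes "robust_pos_invariant l M B W P" "0 \<in> P" "\<forall>t. \<omega> t \<in> W"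
  shows "error_traj l M B \<omega> 0 t \<in> P"
proof (induction t)
  case (Suc t)
  have "((1 / l) *\<^sub>R M) *v error_traj l M B \<omega> 0 t + ((1 / l) *\<^sub>R B) *v \<omega> t
      \<in> (*v) ((1 / l) *\<^sub>R M) ` P + (*v) ((1 / l) *\<^sub>R B) ` W"
    using Suc assms(3) by (intro set_plus_intro) auto
  with assms(1) have "((1 / l) *\<^sub>R M) *v error_traj l M B \<omega> 0 t + ((1 / l) *\<^sub>R B) *v \<omega> t \<in> P"
    unfolding robust_pos_invariant_def by blast
  then show ?case
    by (simp add: scaleR_matrix_vector_assoc[symmetric] scaleR_add_right)
qed (use assms in simp)

text \<open>Choosing 0 from every summand gives the series 0. This supplies the start 0 of the error
  trajectories that stay in P.\<close>

lemma zero_in_min_rpi: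
  assumes "0 \<in> W"
  shows "0 \<in> min_rpi l (M :: real^'n^'n) B W"
proof -
  have pow_0: "((*v) X ^^ i) 0 = 0" for X :: "real^'n^'n" and i
    by (induction i) simp_all
  have "0 \<in> (*v) ((1 / l) *\<^sub>R B) ` W"
    by (rule image_eqI[OF _ assms]) simp
  then have "0 \<in> ((*v) ((1 / l) *\<^sub>R M) ^^ i) ` (*v) ((1 / l) *\<^sub>R B) ` W" for i
    by (rule image_eqI[rotated]) (simp add: pow_0)
  moreover have "(\<lambda>_. 0) sums (0 :: real^'n)"
    by (rule sums_zero)
  ultimately show ?thesis
    unfolding min_rpi_def minkowski_series_def mem_Collect_eq
    by (intro exI[of _ "\<lambda>_. 0"] conjI allI)
qed

text \<open>The two Minkowski differences reserve room for the terms D \<omega> and C \<epsilon>,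
  where \<epsilon> ranges over P.\<close>

lemma tightened_imp_moas_0:
  assumes "robust_pos_invariant l M B W P" "0 \<in> P" "Ybar \<subseteq> Y"
    and "G *v v \<in> Ybar \<ominus> (*v) D ` W \<ominus> (*v) C ` P"
  shows "(v, 0) \<in> moas l M B C G D W Y"
  unfolding moas_def
proof (clarify)
  fix \<omega> :: "nat \<Rightarrow> _" and t assume \<omega>: "\<forall>t. \<omega> t \<in> W"
  have "error_traj l M B \<omega> 0 t \<in> P"
    using assms \<omega> by (intro error_traj_0_in_rpi)
  with assms(4) \<omega> have "G *v v + C *v error_traj l M B \<omega> 0 t + D *v \<omega> t \<in> Ybar"
    unfolding minkowski_diff_def by blast
  with assms(3) show "C *v error_traj l M B \<omega> 0 t + G *v v + D *v \<omega> t \<in> Y"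
    by (auto simp: add.commute)
qed

section \<open>The tightened reference set and the reference governor\<close>

lemma minkowski_diff_eq_Inter: "S \<ominus> T = (\<Inter>t\<in>T. (\<lambda>s. s + t) -` S)"
  by (auto simp: minkowski_diff_def)

lemma closed_minkowski_diff:
  fixes S :: "'a::real_normed_vector set"
  assumes "closed S"
  shows "closed (S \<ominus> T)"
  unfolding minkowski_diff_eq_Inter
  by (intro closed_INT ballI closed_vimage assms continuous_intros)

lemma convex_minkowski_diff:
  fixes S :: "'a::real_vector set"
  assumes "convex S"
  shows "convex (S \<ominus> T)"
proof (rule convexI)
  fix a b and p q :: real
  assume *: "a \<in> S \<ominus> T" "b \<in> S \<ominus> T" "0 \<le> p" "0 \<le> q" "p + q = 1"
  have "p *\<^sub>R a + q *\<^sub>R b + t \<in> S" if "t \<in> T" for t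
  proof -
    have "p *\<^sub>R (a + t) + q *\<^sub>R (b + t) \<in> S"
      using * that by (intro convexD[OF assms]) (auto simp: minkowski_diff_def)
    moreover have "p *\<^sub>R (a + t) + q *\<^sub>R (b + t) = p *\<^sub>R a + q *\<^sub>R b + (p + q) *\<^sub>R t"
      by (simp add: algebra_simps)
    ultimately show ?thesis
      using *(5) by simp
  qed
  then show "p *\<^sub>R a + q *\<^sub>R b \<in> S \<ominus> T"
    by (simp add: minkowski_diff_def)
qed

text \<open>The second assumption is feasibility of a = 0. The feasible values form a nonempty
  compact subset of the unit interval, so a largest one exists.\<close>

lemma ex_rg_solution:
  assumes "closed Oa" "(v, x - S *v v) \<in> Oa"
  shows "\<exists>a. rg_solution Oa S x v r a"
proof -
  let ?F = "{a. rg_feasible Oa S x v r a}"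
  have "?F = {0..1} \<inter> (\<lambda>a. (v + a *\<^sub>R (r - v), x - S *v (v + a *\<^sub>R (r - v)))) -` Oa"
    by (auto simp: rg_feasible_def Let_def)
  moreover have "closed ((\<lambda>a. (v + a *\<^sub>R (r - v), x - S *v (v + a *\<^sub>R (r - v)))) -` Oa)"
    by (intro closed_vimage assms continuous_on_matrix_vector_mult continuous_intros)
  ultimately have "compact ?F"
    by (simp only: compact_Icc compact_Int_closed)
  moreover have "0 \<in> ?F"
    using assms(2) by (simp add: rg_feasible_def)
  ultimately show ?thesis
    unfolding rg_solution_def by (metis compact_attains_sup empty_iff mem_Collect_eq)
qed

text \<open>Only once a maximum is known to exist does \<open>GREATEST\<close> denote it; this ties
  the \<alpha> of the closed loop to a genuine solution.\<close>

lemma rg_feasible_Greatest: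
  assumes "rg_solution Oa S x v r a"
  shows "rg_feasible Oa S x v r (GREATEST a. rg_feasible Oa S x v r a)"
proof -
  have "(GREATEST a. rg_feasible Oa S x v r a) = a"
    using assms by (intro Greatest_equality) (auto simp: rg_solution_def)
  with assms show ?thesis
    by (simp add: rg_solution_def)
qed

section \<open>Recursive feasibility and constraint satisfaction of the closed loop\<close>

theorem lemma1:
  fixes A :: "real^'n^'n" and B :: "real^'m^'n" and B\<^sub>w :: "real^'o^'n"
    and C\<^sub>o :: "real^'n^'p" and D :: "real^'m^'p" and D\<^sub>w :: "real^'o^'p"
    and K :: "real^'n^'m"
    and Y Ybar :: "(real^'p) set" and W :: "(real^'o) set" and P :: "(real^'n) set"
    and L :: "nat \<Rightarrow> (real^'m) \<times> (real^'n) \<Rightarrow> real"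
    and l\<^sub>L \<alpha>\<^sub>v l\<^sub>v lam \<gamma> :: real
    and x\<^sub>0 :: "real^'n" and r\<^sub>0 :: "real^'m"
    and w :: "nat \<Rightarrow> real^'o" and x :: "nat \<Rightarrow> real^'n" and u v r :: "nat \<Rightarrow> real^'m"
    and \<alpha> :: "nat \<Rightarrow> real" and y :: "nat \<Rightarrow> real^'p"
  assumes A\<^sub>K: "A\<^sub>K = A + B ** K"
    and C: "C = C\<^sub>o + D ** K"
    and S\<^sub>K: "S\<^sub>K = steady_state_map A\<^sub>K B"
    and S\<^sub>v: "S\<^sub>v = {z. (C ** S\<^sub>K + D) *v z \<in> Y \<ominus> (*v) D\<^sub>w ` W}"
    and S\<^sub>vbar: "S\<^sub>vbar = {z. (C ** S\<^sub>K + D) *v z \<in> Ybar \<ominus> (*v) D\<^sub>w ` W \<ominus> (*v) C ` P}"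
    and Oinf: "Oinf = moas lam A\<^sub>K B\<^sub>w C (C ** S\<^sub>K + D) D\<^sub>w W Y"
    and Ls: "Ls = (\<lambda>t z. L t (z + K *v (S\<^sub>K *v z), S\<^sub>K *v z))"
    and "stabilizable A B" and "schur_stable A\<^sub>K"
    and "compact Y" and "convex Y" and "0 \<in> interior Y"
    and "compact W" and "convex W" and "0 \<in> interior W" and "\<forall>t. w t \<in> W"
    and "l\<^sub>L > 0" and "\<alpha>\<^sub>v > 0" and "l\<^sub>v > 0"
    and "\<forall>t. l\<^sub>L-lipschitz_on {(a, b). C\<^sub>o *v b + D *v a \<in> Y} (L t)"
    and "\<forall>t. strongly_convex_on \<alpha>\<^sub>v S\<^sub>v (Ls t)"
    and "\<forall>t. \<forall>z\<in>S\<^sub>v. Ls t differentiable at z"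
    and "\<forall>t. l\<^sub>v-lipschitz_on S\<^sub>v (gradient (Ls t))"
    and "spectral_radius A\<^sub>K < lam" and "lam < 1"
    and "robust_pos_invariant lam A\<^sub>K B\<^sub>w W P" and "min_rpi lam A\<^sub>K B\<^sub>w W \<subseteq> P"
    and "convex Ybar" and "compact Ybar" and "0 \<in> Ybar" and "Ybar \<subseteq> interior Y"
    and "0 < \<gamma>" and "\<gamma> \<le> 2 / (\<alpha>\<^sub>v + l\<^sub>v)"
    and "r\<^sub>0 \<in> S\<^sub>vbar" and "(r\<^sub>0, x\<^sub>0 - S\<^sub>K *v r\<^sub>0) \<in> Oinf"
    and "oco_rg_closed_loop A B B\<^sub>w K S\<^sub>K Oinf S\<^sub>vbar Ls \<gamma> x\<^sub>0 r\<^sub>0 w x u v r \<alpha>"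
    and "\<forall>t. y t = C\<^sub>o *v x t + D *v u t + D\<^sub>w *v w t"
  shows "recursively_feasible Oinf S\<^sub>K x v r \<and> (\<forall>t. y t \<in> Y)"
proof -
  note loop = \<open>oco_rg_closed_loop A B B\<^sub>w K S\<^sub>K Oinf S\<^sub>vbar Ls \<gamma> x\<^sub>0 r\<^sub>0 w x u v r \<alpha>\<close>[unfolded oco_rg_closed_loop_def]
  have v_Suc: "v (Suc t) = v t + \<alpha> (Suc t) *\<^sub>R (r (Suc t) - v t)" for t
    using loop by blast
  have \<alpha>_Suc: "\<alpha> (Suc t) = (GREATEST a. rg_feasible Oinf S\<^sub>K (x (Suc t)) (v t) (r (Suc t)) a)" for t
    using loop by blast
  have u: "u t = v t + K *v x t" for t
    using loop by blast
  have x_Suc: "x (Suc t) = A\<^sub>K *v x t + B *v v t + B\<^sub>w *v w t" for t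
  proof -
    have "x (Suc t) = A *v x t + B *v u t + B\<^sub>w *v w t"
      using loop by blast
    then show ?thesis
      by (simp add: A\<^sub>K u matrix_vector_mult_add_rdistrib matrix_vector_right_distrib
          matrix_vector_mul_assoc)
  qed
  have lam_pos: "0 < lam"
    using spectral_radius_nonneg \<open>spectral_radius A\<^sub>K < lam\<close> by (rule le_less_trans)
  have fix_SK: "A\<^sub>K *v (S\<^sub>K *v z) + B *v z = S\<^sub>K *v z" for z
    unfolding S\<^sub>K by (rule steady_state_map_fixpoint) fact
  have Svbar_vimage:
    "S\<^sub>vbar = (*v) (C ** S\<^sub>K + D) -` (Ybar \<ominus> (*v) D\<^sub>w ` W \<ominus> (*v) C ` P)"
    by (auto simp: S\<^sub>vbar)
  have closed_Svbar: "closed S\<^sub>vbar"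
    unfolding Svbar_vimage
    by (intro closed_vimage closed_minkowski_diff compact_imp_closed \<open>compact Ybar\<close>
        matrix_vector_mult_linear_continuous_on)
  have convex_Svbar: "convex S\<^sub>vbar"
    unfolding Svbar_vimage
    by (intro convex_linear_vimage convex_minkowski_diff \<open>convex Ybar\<close>) simp
  have r_Svbar: "r t \<in> S\<^sub>vbar" for t
  proof (cases t)
    case 0
    then show ?thesis
      using loop \<open>r\<^sub>0 \<in> S\<^sub>vbar\<close> by simp
  next
    case (Suc k)
    \<comment> \<open>The projection lies in the set because the set is closed and contains
      \<open>r\<^sub>0\<close>.\<close>
    have "closest_point S\<^sub>vbar z \<in> S\<^sub>vbar" for z
      using closed_Svbar \<open>r\<^sub>0 \<in> S\<^sub>vbar\<close> by (intro closest_point_in_set) auto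
    then show ?thesis
      using loop Suc by simp
  qed
  have closed_Oinf: "closed Oinf"
    unfolding Oinf by (intro closed_moas compact_imp_closed \<open>compact Y\<close>)
  have P0: "0 \<in> P"
    using zero_in_min_rpi \<open>min_rpi lam A\<^sub>K B\<^sub>w W \<subseteq> P\<close> \<open>0 \<in> interior W\<close> interior_subset by blast
  have moas_0: "(z, 0) \<in> Oinf" if "z \<in> S\<^sub>vbar" for z
    unfolding Oinf
  proof (rule tightened_imp_moas_0)
    show "robust_pos_invariant lam A\<^sub>K B\<^sub>w W P"
      by fact
    show "Ybar \<subseteq> Y"
      using \<open>Ybar \<subseteq> interior Y\<close> interior_subset by blast
  qed (use that P0 S\<^sub>vbar in auto)
  \<comment> \<open>Here the reference is held at v t while the state moves on, which is the choice
    \<alpha> = 0 in the next governor problem.\<close>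
  have next_admissible: "(v t, x (Suc t) - S\<^sub>K *v v t) \<in> Oinf"
    if "(v t, x t - S\<^sub>K *v v t) \<in> Oinf" "v t \<in> S\<^sub>vbar" for t
  proof -
    let ?e = "A\<^sub>K *v (x t - S\<^sub>K *v v t) + B\<^sub>w *v w t"
    have "x (Suc t) - S\<^sub>K *v v t = ?e"
      \<comment> \<open>Subtracting the equilibrium equation cancels the input term B v and leaves
        the error dynamics.\<close>
      unfolding x_Suc by (subst fix_SK[symmetric]) (simp add: matrix_vector_mult_diff_distrib)
    moreover have "(v t, (1 / lam) *\<^sub>R ?e) \<in> Oinf"
      unfolding Oinf
      by (rule moas_step[OF that(1)[unfolded Oinf]]) (use \<open>\<forall>t. w t \<in> W\<close> in simp)
    \<comment> \<open>Shrinking by \<lambda> undoes the scaling in \<open>moas_step\<close>; the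
      second endpoint is the admissible pair with error 0.\<close>
    then have "(v t, lam *\<^sub>R (1 / lam) *\<^sub>R ?e) \<in> Oinf"
      unfolding Oinf
      by (rule moas_scaleR[OF \<open>convex Y\<close> _ moas_0[OF that(2), unfolded Oinf]])
        (use lam_pos \<open>lam < 1\<close> in auto)
    ultimately show ?thesis
      using lam_pos by simp
  qed
  have solution: "\<exists>a. rg_solution Oinf S\<^sub>K (x (Suc t)) (v t) (r (Suc t)) a"
    if "(v t, x t - S\<^sub>K *v v t) \<in> Oinf" "v t \<in> S\<^sub>vbar" for t
    by (intro ex_rg_solution closed_Oinf next_admissible that)
  \<comment> \<open>Membership of v t in the tightened set is carried along because
    \<open>next_admissible\<close> needs both facts; it persists since v (t + 1) is a convex
    combination of v t and r (t + 1).\<close>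
  have invariant: "(v t, x t - S\<^sub>K *v v t) \<in> Oinf \<and> v t \<in> S\<^sub>vbar" for t
  proof (induction t)
    case 0
    then show ?case
      using loop \<open>(r\<^sub>0, x\<^sub>0 - S\<^sub>K *v r\<^sub>0) \<in> Oinf\<close> \<open>r\<^sub>0 \<in> S\<^sub>vbar\<close> by simp
  next
    case (Suc t)
    then obtain a where "rg_solution Oinf S\<^sub>K (x (Suc t)) (v t) (r (Suc t)) a"
      using solution by blast
    then have "rg_feasible Oinf S\<^sub>K (x (Suc t)) (v t) (r (Suc t)) (\<alpha> (Suc t))"
      unfolding \<alpha>_Suc by (rule rg_feasible_Greatest)
    then have \<alpha>: "0 \<le> \<alpha> (Suc t)" "\<alpha> (Suc t) \<le> 1"
      and adm: "(v (Suc t), x (Suc t) - S\<^sub>K *v v (Suc t)) \<in> Oinf"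
      by (simp_all add: rg_feasible_def Let_def v_Suc)
    have "(1 - \<alpha> (Suc t)) *\<^sub>R v t + \<alpha> (Suc t) *\<^sub>R r (Suc t) \<in> S\<^sub>vbar"
      using \<alpha> Suc r_Svbar by (intro convexD[OF convex_Svbar]) auto
    moreover have "v (Suc t) = (1 - \<alpha> (Suc t)) *\<^sub>R v t + \<alpha> (Suc t) *\<^sub>R r (Suc t)"
      by (subst v_Suc) (simp add: algebra_simps)
    ultimately show ?case
      using adm by simp
  qed
  have "rg_solvable_at Oinf S\<^sub>K x v r t" for t
    using invariant solution by (cases t) auto
  moreover have "y t \<in> Y" for t
  proof -
    \<comment> \<open>The terms in \<open>S\<^sub>K\<close> cancel, so this is the actual output y
      t.\<close>
    have "C *v (x t - S\<^sub>K *v v t) + (C ** S\<^sub>K + D) *v v t + D\<^sub>w *v w t \<in> Y"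
      by (rule moas_output[OF invariant[of t, THEN conjunct1, unfolded Oinf]])
        (use \<open>\<forall>t. w t \<in> W\<close> in simp)
    moreover have "y t = C *v x t + D *v v t + D\<^sub>w *v w t"
      using \<open>\<forall>t. y t = C\<^sub>o *v x t + D *v u t + D\<^sub>w *v w t\<close>
      by (simp add: C u matrix_vector_mult_add_rdistrib matrix_vector_right_distrib
          matrix_vector_mul_assoc)
    ultimately show ?thesis
      by (simp add: matrix_vector_mult_diff_distrib matrix_vector_mult_add_rdistrib
          matrix_vector_mul_assoc)
  qed
  ultimately show ?thesis
    by (simp add: recursively_feasible_def)
qed

end
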